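(* Let $J,M\ge1$ be integers, let $p,\bar f\ge0$, $b\ge1$, and let $s_j\ge0$, $\eta_j>1$ for $j=1,\dots,J$. Let $f:[0,\infty)\to\mathbb{R}$ be non-decreasing and let $\{D^{(\ell)}\}_{\ell\ge1}$ be an arbitrary non-negative sequence. Let $\{R^{(k)}\}_{k\ge1}$ be a non-negative sequence satisfying, for all $k\ge1$, $$R^{(k+1)}\le p^k\,b\,R^{(1)}+\sum_{\ell=1}^k p^{k-\ell}\Big\{\sum_{j=1}^J s_j\max_{\max\{1,\ell-M\}\le q\le\ell}(R^{(q)})^{\eta_j}+\Big(\max_{\ell\le q\le k}f(R^{(q)})-\bar f\Big)D^{(\ell)}\Big\}.$$ Suppose that $$\bar f\ge f(bR^{(1)})\qquad\text{and}\qquad\delta:=p+\sum_{j=1}^J s_j(bR^{(1)})^{\eta_j-1}<1.$$ Then there exists a sequence $\{\bar R^{(k)}\}_{k\ge1}$ satisfying (i) $\bar R^{(k)}\ge R^{(k)}$ for all $k\ge1$; (ii) $\bar R^{(k+1)}\le\delta^{\lceil k/M\rceil}\,(b\bar R^{(1)})$ for all $k\ge1$; (iii) $\lim_{k\to\infty}\bar R^{(k+1)}/\bar R^{(k)}=p$. *)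

theory Defs
  imports Complex_Main
begin

end

theory Submission
  imports Defs
begin

text \<open>
  By induction \<open>R k \<le> b R 1\<close>, so the terms with \<open>D\<close> are nonpositive and can be dropped, and \<open>R (k + 1)\<close> is
  dominated by a solution \<open>T k\<close> of a recursion \<open>T (k + 1) \<le> p T k + \<sigma> T q\<close> with \<open>q\<close> in the window
  \<open>{k - M..k}\<close>. With \<open>\<sigma> = \<delta> - p\<close> this gives geometric decay; then \<open>R \<longlonglongrightarrow> 0\<close> lets \<open>\<sigma>\<close> become
  arbitrarily small because \<open>\<eta> j > 1\<close>, and so \<open>R k = O(r ^ k)\<close> for every \<open>r > p\<close>. The infimum over
  \<open>r > p\<close> of these geometric bounds is a majorant whose ratios converge to \<open>p\<close>. If \<open>p < \<delta>\<close>, it is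
  \<open>O(\<delta> ^ k)\<close>, and enlarging its first term absorbs the constant; if \<open>p = \<delta>\<close>, the sequence \<open>R\<close> is
  itself bounded by a multiple of \<open>p ^ k\<close>.
\<close>

section \<open>Geometric decay under a recursion with bounded delay\<close>

text \<open>A delay of at most \<open>M\<close> costs a factor of at most \<open>1 / r ^ M\<close>,
  as \<open>r \<le> 1\<close>; \<open>rate\<close> is exactly what closes the induction after paying
  it.\<close>

lemma window_recursion_decay:
  fixes a :: "nat \<Rightarrow> real"
  assumes p: "p \<ge> 0" and \<sigma>: "\<sigma> \<ge> 0" and r: "0 < r" "r \<le> 1"
    and rate: "p + \<sigma> / r ^ M \<le> r"
    and rec: "\<And>k. k \<ge> K \<Longrightarrow> \<exists>q\<in>{k - M..k}. a (Suc k) \<le> p * a k + \<sigma> * a q"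
  shows "\<exists>C. \<forall>k. a k \<le> C * r ^ k"
proof -
  \<comment> \<open>\<open>C\<close> covers the values up to \<open>K\<close>, where
    \<open>rec\<close> may fail; the inserted 0 gives \<open>C \<ge> 0\<close> even if all those
    values are negative.\<close>
  define C where "C = Max (insert 0 ((\<lambda>k. a k / r ^ k) ` {..K}))"
  have C0: "C \<ge> 0" unfolding C_def by (rule Max_ge) auto
  have base: "a k \<le> C * r ^ k" if "k \<le> K" for k
  proof -
    have "a k / r ^ k \<le> C" unfolding C_def using that by (intro Max_ge) auto
    then show ?thesis using r by (simp add: field_simps)
  qed
  have "a k \<le> C * r ^ k" for k
  proof (induction k rule: less_induct)
    case (less k)
    show ?case
    proof (cases "k \<le> K")
      case False
      then obtain m where k: "k = Suc m" and m: "m \<ge> K" by (cases k) auto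
      obtain q where q: "q \<in> {m - M..m}" and le: "a (Suc m) \<le> p * a m + \<sigma> * a q"
        using rec[OF m] by blast
      have "r ^ q * r ^ M \<le> r ^ m"
        unfolding power_add[symmetric] using q r by (intro power_decreasing) auto
      then have rq: "r ^ q \<le> r ^ m / r ^ M" using r by (simp add: field_simps)
      have "a q \<le> C * r ^ q" using less q k by auto
      also have "\<dots> \<le> C * (r ^ m / r ^ M)" by (rule mult_left_mono[OF rq C0])
      finally have "\<sigma> * a q \<le> \<sigma> * (C * (r ^ m / r ^ M))" using \<sigma> by (rule mult_left_mono)
      moreover have "p * a m \<le> p * (C * r ^ m)" using less k p by (intro mult_left_mono) auto
      ultimately have "a k \<le> p * (C * r ^ m) + \<sigma> * (C * (r ^ m / r ^ M))" using le k by simp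
      also have "\<dots> = (p + \<sigma> / r ^ M) * (C * r ^ m)" by (simp add: algebra_simps)
      also have "\<dots> \<le> r * (C * r ^ m)" using rate C0 r by (intro mult_right_mono) auto
      finally show ?thesis using k by (simp add: mult_ac)
    qed (use base in auto)
  qed
  then show ?thesis by blast
qed

section \<open>Majorants with convergent ratios\<close>

text \<open>The terms of the exponential series at \<open>1 / r\<close> are bounded. This supplies a
  positive sequence that can be added without spoiling any geometric growth bound.\<close>

lemma inverse_fact_le_geometric:
  fixes r :: real
  assumes "r > 0"
  shows "\<exists>C. \<forall>k. inverse (fact k) \<le> C * r ^ k"
proof -
  have "summable (\<lambda>k. inverse (fact k) * (1 / r) ^ k)"
    by (rule summable_exp)
  then have "Bseq (\<lambda>k. inverse (fact k) * (1 / r) ^ k)"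
    by (intro convergent_imp_Bseq) (auto simp: convergent_def dest: summable_LIMSEQ_zero)
  then obtain C where C: "\<And>k. norm (inverse (fact k) * (1 / r) ^ k) \<le> C"
    unfolding Bseq_def by blast
  have "inverse (fact k) \<le> C * r ^ k" for k
    using C[of k] assms by (simp add: field_simps)
  then show ?thesis by blast
qed

text \<open>An infimum of geometric sequences is log-concave, so its ratios decrease; their limit cannot
  exceed \<^term>\<open>p\<close> because the infimum lies below geometric sequences of every rate \<open>r > p\<close>.\<close>

lemma ratio_convergent_majorant:
  fixes a :: "nat \<Rightarrow> real"
  assumes p: "p \<ge> 0"
    and growth: "\<And>r. r > p \<Longrightarrow> \<exists>C. \<forall>k. a k \<le> C * r ^ k"
    and nonneg: "\<And>k. a k \<ge> 0"
  obtains V :: "nat \<Rightarrow> real" where "\<And>k. V k > 0" "\<And>k. a k \<le> V k"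
    "\<And>r. r > p \<Longrightarrow> \<exists>C. \<forall>k. V k \<le> C * r ^ k"
    "(\<lambda>k. V (Suc k) / V k) \<longlonglongrightarrow> p"
proof -
  \<comment> \<open>The added term makes the sequence strictly positive, so that ratios of
    \<open>V\<close> make sense even where \<open>a\<close> vanishes.\<close>
  define c where "c k = a k + inverse (fact k)" for k
  have c: "c k > 0" "a k \<le> c k" for k
    using nonneg[of k] by (auto simp: c_def add_nonneg_pos)
  have "\<exists>C. \<forall>k. c k \<le> C * r ^ k" if r: "r > p" for r
  proof -
    obtain C1 C2 where "\<And>k. a k \<le> C1 * r ^ k" "\<And>k. inverse (fact k) \<le> C2 * r ^ k"
      using growth[OF r] inverse_fact_le_geometric[of r] p r by (metis order_le_less_trans)
    then have "c k \<le> (C1 + C2) * r ^ k" for k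
      unfolding c_def by (simp add: distrib_right add_mono)
    then show ?thesis by blast
  qed
  then obtain C where C: "\<And>r k. r > p \<Longrightarrow> c k \<le> C r * r ^ k" by metis
  define V where "V k = (INF r\<in>{p<..}. C r * r ^ k)" for k
  have bdd: "bdd_below ((\<lambda>r. C r * r ^ k) ` {p<..})" for k
    using C by (intro bdd_belowI[of _ "c k"]) auto
  have Vle: "V k \<le> C r * r ^ k" if "r > p" for r k
    unfolding V_def using bdd that by (intro cINF_lower) auto
  have leV: "x \<le> V k" if "\<And>r. r > p \<Longrightarrow> x \<le> C r * r ^ k" for x k
    unfolding V_def using that by (intro cINF_greatest) auto
  have cV: "c k \<le> V k" for k using C by (intro leV)
  have V0: "V k > 0" for k using cV[of k] c(1)[of k] by simp
  have pV: "p * V k \<le> V (Suc k)" for k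
  proof (rule leV)
    fix r assume r: "r > p"
    have "p * V k \<le> r * (C r * r ^ k)"
      using r p Vle[OF r] V0[of k] by (intro mult_mono) auto
    then show "p * V k \<le> C r * r ^ Suc k" by (simp add: mult_ac)
  qed
  \<comment> \<open>Each geometric sequence satisfies this with equality. The square root puts the
    claim in the form of a lower bound for the infimum, so \<open>leV\<close> applies.\<close>
  have concave: "V k * V (Suc (Suc k)) \<le> (V (Suc k))\<^sup>2" for k
  proof -
    have "sqrt (V k * V (Suc (Suc k))) \<le> V (Suc k)"
    proof (rule leV)
      fix r assume r: "r > p"
      have "V k * V (Suc (Suc k)) \<le> (C r * r ^ k) * (C r * r ^ Suc (Suc k))"
        by (rule mult_mono[OF Vle[OF r] Vle[OF r]
              less_imp_le[OF order_less_le_trans[OF V0 Vle[OF r]]] less_imp_le[OF V0]])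
      also have "\<dots> = (C r * r ^ Suc k)\<^sup>2" by (simp add: power2_eq_square mult_ac)
      finally show "sqrt (V k * V (Suc (Suc k))) \<le> C r * r ^ Suc k"
        using C[OF r, of "Suc k"] c(1)[of "Suc k"] by (intro real_le_lsqrt) auto
    qed
    then show ?thesis using V0 by (simp add: sqrt_le_D)
  qed
  define \<rho> where "\<rho> k = V (Suc k) / V k" for k
  have dec: "decseq \<rho>"
    using concave V0 unfolding \<rho>_def
    by (intro decseq_SucI) (simp add: field_simps power2_eq_square)
  have \<rho>p: "p \<le> \<rho> k" for k using pV[of k] V0[of k] by (simp add: \<rho>_def field_simps)
  obtain L where L: "\<rho> \<longlonglongrightarrow> L" "\<And>k. L \<le> \<rho> k"
    using decseq_convergent[OF dec, of p] \<rho>p by blast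
  have "p \<le> L" using L(1) \<rho>p by (intro LIMSEQ_le_const) auto
  moreover have "L \<le> p"
  proof (rule ccontr)
    assume "\<not> L \<le> p"
    then obtain r where r: "p < r" "r < L" using dense by (metis not_le)
    have r0: "r > 0" using r p by simp
    \<comment> \<open>Ratios of at least \<open>L\<close> force growth at least like
      \<open>L ^ k\<close>, which no bound of rate \<open>r < L\<close> can permit.\<close>
    have low: "V 0 * L ^ k \<le> V k" for k
    proof (induction k)
      case (Suc k)
      have "L * V k \<le> V (Suc k)" using L(2)[of k] V0[of k] by (simp add: \<rho>_def field_simps)
      moreover have "L * (V 0 * L ^ k) \<le> L * V k" using Suc r r0 by (intro mult_left_mono) auto
      ultimately show ?case by (simp add: mult_ac)
    qed simp
    have "(L / r) ^ k \<le> C r / V 0" for k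
    proof -
      have "V 0 * L ^ k \<le> C r * r ^ k" using low Vle[OF r(1)] by (rule order_trans)
      then show ?thesis using V0[of 0] r0 by (simp add: field_simps power_divide)
    qed
    moreover obtain n where "C r / V 0 < (L / r) ^ n"
      using real_arch_pow[of "L / r" "C r / V 0"] r r0 by auto
    ultimately show False by (meson not_le)
  qed
  ultimately have "\<rho> \<longlonglongrightarrow> p" using L(1) by simp
  moreover have "a k \<le> V k" for k using c(2) cV by (rule order_trans)
  ultimately show ?thesis using that[of V] V0 Vle unfolding \<rho>_def by blast
qed

theorem proposition6:
  fixes J M :: nat
    and p fbar b \<delta> :: real
    and s \<eta> :: "nat \<Rightarrow> real"
    and f :: "real \<Rightarrow> real"
    and D R :: "nat \<Rightarrow> real"
  assumes "J \<ge> 1" and "M \<ge> 1"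
    and "p \<ge> 0" and "fbar \<ge> 0" and "b \<ge> 1"
    and "\<And>j. j \<in> {1..J} \<Longrightarrow> s j \<ge> 0"
    and "\<And>j. j \<in> {1..J} \<Longrightarrow> \<eta> j > 1"
    and "mono_on {0..} f"
    and "\<And>l. l \<ge> 1 \<Longrightarrow> D l \<ge> 0"
    and "\<And>k. k \<ge> 1 \<Longrightarrow> R k \<ge> 0"
    and "\<And>k. k \<ge> 1 \<Longrightarrow>
      R (k + 1) \<le> p ^ k * b * R 1 +
        (\<Sum>l=1..k. p ^ (k - l) *
          ((\<Sum>j=1..J. s j * (MAX q\<in>{max 1 (l - M)..l}. R q powr \<eta> j)) +
           ((MAX q\<in>{l..k}. f (R q)) - fbar) * D l))"
    and "fbar \<ge> f (b * R 1)"
    and "\<delta> = p + (\<Sum>j=1..J. s j * (b * R 1) powr (\<eta> j - 1))"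
    and "\<delta> < 1"
  shows "\<exists>Rbar :: nat \<Rightarrow> real.
      (\<forall>k\<ge>1. Rbar k \<ge> R k) \<and>
      (\<forall>k\<ge>1. Rbar (k + 1) \<le> \<delta> ^ nat \<lceil>real k / real M\<rceil> * (b * Rbar 1)) \<and>
      (\<delta> \<noteq> 0 \<longrightarrow> (\<forall>k\<ge>1. Rbar k \<noteq> 0)) \<and>
      (\<lambda>k. Rbar (k + 1) / Rbar k) \<longlonglongrightarrow> p"
proof -
  note M = assms(2) and p = assms(3) and b = assms(5) and s = assms(6)
    and \<eta> = assms(7) and f = assms(8) and D = assms(9) and R = assms(10) and rec = assms(11)
    and fB = assms(12) and \<delta> = assms(13) and \<delta>1 = assms(14)

  \<comment> \<open>The comparison sequence \<open>T\<close> and the bound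
    \<open>R k \<le> B\<close>\<close>
  define B where "B = b * R 1"
  \<comment> \<open>Splitting off one factor \<open>x\<close> from each
    \<open>x powr \<eta> j\<close> leaves \<open>\<phi> x\<close>, the coefficient of an otherwise
    linear recursion.\<close>
  define \<phi> where "\<phi> x = (\<Sum>j=1..J. s j * x powr (\<eta> j - 1))" for x
  define G where "G l = (\<Sum>j=1..J. s j * (MAX q\<in>{max 1 (l - M)..l}. R q powr \<eta> j))" for l
  define T where "T k = p ^ k * B + (\<Sum>l=1..k. p ^ (k - l) * G l)" for k
  have B0: "B \<ge> 0" and RB1: "R 1 \<le> B"
    using b R[of 1] by (auto simp: B_def mult_le_cancel_right1 mult_nonneg_nonneg)
  have \<phi>0: "\<phi> x \<ge> 0" for x unfolding \<phi>_def using s by (intro sum_nonneg mult_nonneg_nonneg) auto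
  have \<phi>_mono: "\<phi> x \<le> \<phi> y" if "0 \<le> x" "x \<le> y" for x y
    unfolding \<phi>_def
  proof (intro sum_mono mult_left_mono powr_mono2)
    fix j assume "j \<in> {1..J}"
    then show "0 \<le> \<eta> j - 1" using \<eta>[of j] by simp
  qed (use s that in auto)
  have \<delta>\<phi>: "\<delta> = p + \<phi> B" unfolding \<delta> \<phi>_def B_def ..
  have p\<delta>: "p \<le> \<delta>" using \<phi>0[of B] \<delta>\<phi> by simp
  have T_Suc: "T (Suc k) = p * T k + G (Suc k)" for k
  proof -
    have "(\<Sum>l=1..k. p ^ (Suc k - l) * G l) = p * (\<Sum>l=1..k. p ^ (k - l) * G l)"
      unfolding sum_distrib_left by (intro sum.cong) (auto simp: Suc_diff_le)
    then show ?thesis unfolding T_def by (simp add: algebra_simps)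
  qed
  \<comment> \<open>One index attains the maximum for all \<open>j\<close> at once, since every
    power is monotone. The shift to \<open>Suc q\<close> matches the later bound
    \<open>R (Suc q) \<le> T q\<close>.\<close>
  have G: "\<exists>q\<in>{k - M..k}. G (Suc k) = \<phi> (R (Suc q)) * R (Suc q)" for k
  proof -
    let ?W = "{max 1 (Suc k - M)..Suc k}"
    have "Max (R ` ?W) \<in> R ` ?W" using M by (intro Max_in) auto
    then obtain q where q: "q \<in> ?W" "R q = Max (R ` ?W)" by (metis imageE)
    have le: "R i \<le> R q" if "i \<in> ?W" for i unfolding q(2) using that by (intro Max_ge) auto
    have "(MAX i\<in>?W. R i powr \<eta> j) = R q powr (\<eta> j - 1) * R q" if "j \<in> {1..J}" for j
    proof -
      have "(MAX i\<in>?W. R i powr \<eta> j) = R q powr \<eta> j"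
        using q(1) le R \<eta>[OF that] by (intro Max_eqI) (auto intro!: powr_mono2)
      also have "\<dots> = R q powr (\<eta> j - 1) * R q powr 1"
        unfolding powr_add[symmetric] by simp
      finally show ?thesis using R[of q] q(1) by simp
    qed
    then have "G (Suc k) = \<phi> (R q) * R q"
      unfolding G_def \<phi>_def by (simp add: sum_distrib_right mult.assoc)
    moreover obtain q' where "q = Suc q'" using q(1) by (cases q) auto
    ultimately show ?thesis using q(1) by (intro bexI[of _ q']) auto
  qed
  \<comment> \<open>Only values up to index \<open>k\<close> must be bounded by \<open>B\<close>, so
    this can be used inside the induction that proves \<open>RB\<close>.\<close>
  have RT_if: "R (Suc k) \<le> T k" if below: "\<And>q. 1 \<le> q \<Longrightarrow> q \<le> k \<Longrightarrow> R q \<le> B" for k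
  proof (cases "k = 0")
    case True
    then show ?thesis using RB1 by (simp add: T_def)
  next
    case False
    have "R (k + 1) \<le> p ^ k * B + (\<Sum>l=1..k. p ^ (k - l) *
        (G l + ((MAX q\<in>{l..k}. f (R q)) - fbar) * D l))"
      using rec[of k] False unfolding G_def B_def by (simp add: mult.assoc)
    also have "\<dots> \<le> T k" unfolding T_def
    proof (intro add_left_mono sum_mono mult_left_mono)
      fix l assume l: "l \<in> {1..k}"
      have "f (R q) \<le> fbar" if "q \<in> {l..k}" for q
      proof -
        have "f (R q) \<le> f B"
          using mono_onD[OF f, of "R q" B] R[of q] below[of q] that l B0 by auto
        then show ?thesis using fB by (simp add: B_def)
      qed
      then have "(MAX q\<in>{l..k}. f (R q)) \<le> fbar" using l by (subst Max_le_iff) auto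
      then show "G l + ((MAX q\<in>{l..k}. f (R q)) - fbar) * D l \<le> G l"
        using D[of l] l by (simp add: mult_nonpos_nonneg)
    qed (use p in auto)
    finally show ?thesis by simp
  qed
  have RB: "R k \<le> B" if "k \<ge> 1" for k
    using that
  proof (induction k rule: less_induct)
    case (less k)
    then obtain m where m: "k = Suc m" by (cases k) auto
    \<comment> \<open>The inner induction works because the window for \<open>T (Suc i)\<close>
      involves only values of \<open>R\<close> with index at most \<open>m\<close>, which the outer
      hypothesis covers.\<close>
    have "T i \<le> B" if "i \<le> m" for i
      using that
    proof (induction i)
      case (Suc i)
      obtain q where q: "q \<in> {i - M..i}" "G (Suc i) = \<phi> (R (Suc q)) * R (Suc q)"
        using G by blast
      have Rq: "0 \<le> R (Suc q)" "R (Suc q) \<le> B" using R less.IH[of "Suc q"] q(1) Suc.prems m by auto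
      have "p * T i \<le> p * B" using Suc p by (intro mult_left_mono) auto
      moreover have "G (Suc i) \<le> \<phi> B * B"
        unfolding q(2) using Rq \<phi>0 \<phi>_mono by (intro mult_mono) auto
      ultimately have "T (Suc i) \<le> \<delta> * B" unfolding T_Suc \<delta>\<phi> by (simp add: distrib_right)
      also have "\<dots> \<le> B" using \<delta>1 B0 by (simp add: mult_left_le_one_le p p\<delta> order_trans[OF p p\<delta>])
      finally show ?case .
    qed (simp add: T_def)
    moreover have "R (Suc m) \<le> T m" using less m by (intro RT_if) auto
    ultimately show ?case using m by force
  qed
  have RT: "R (Suc k) \<le> T k" for k using RB by (intro RT_if)
  have step: "\<exists>q\<in>{k - M..k}. T (Suc k) \<le> p * T k + \<sigma> * T q"
    if "\<And>q. q \<in> {k - M..k} \<Longrightarrow> \<phi> (R (Suc q)) \<le> \<sigma>" for k \<sigma>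
  proof -
    obtain q where q: "q \<in> {k - M..k}" "G (Suc k) = \<phi> (R (Suc q)) * R (Suc q)"
      using G by blast
    have "G (Suc k) \<le> \<sigma> * T q"
      unfolding q(2) using that[OF q(1)] RT[of q] R[of "Suc q"] \<phi>0[of "R (Suc q)"]
      by (intro mult_mono) auto
    then show ?thesis using q(1) unfolding T_Suc by auto
  qed
  have \<phi>R: "\<phi> (R (Suc q)) \<le> \<phi> B" for q using R RB by (intro \<phi>_mono) auto
  \<comment> \<open>Since \<open>\<delta>\<close> lies in \<open>[0, 1)\<close>, the stronger rate
    \<open>\<delta> ^ k\<close> therefore suffices for (ii).\<close>
  have exponent_le: "nat \<lceil>real k / real M\<rceil> \<le> k" for k
  proof -
    have "real k / real M \<le> real k / 1" using M by (intro divide_left_mono) auto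
    then show ?thesis by linarith
  qed

  show ?thesis
  proof (cases "\<delta> = p")
    case True
    then have "\<phi> B = 0" using \<delta>\<phi> by simp
    then have "\<phi> (R (Suc q)) = 0" for q using \<phi>R[of q] \<phi>0[of "R (Suc q)"] by simp
    then have "G (Suc k) = 0" for k using G[of k] by auto
    then have "G l = 0" if "l \<ge> 1" for l using that by (cases l) auto
    then have T: "T k = p ^ k * B" for k by (simp add: T_def)
    \<comment> \<open>The summand 1 keeps the majorant nonzero when \<open>R 1 = 0\<close> and
      \<open>\<delta> \<noteq> 0\<close>.\<close>
    define Rbar where "Rbar k = p ^ (k - 1) * (B + 1)" for k
    have "R k \<le> Rbar k" if "k \<ge> 1" for k
    proof -
      have "R k \<le> p ^ (k - 1) * B" using RT[of "k - 1"] T that by simp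
      also have "\<dots> \<le> Rbar k" unfolding Rbar_def using p by (intro mult_left_mono) auto
      finally show ?thesis .
    qed
    moreover have "Rbar (k + 1) \<le> \<delta> ^ nat \<lceil>real k / real M\<rceil> * (b * Rbar 1)" for k
    proof -
      have "p ^ k \<le> \<delta> ^ nat \<lceil>real k / real M\<rceil>"
        using True p \<delta>1 exponent_le[of k] by (auto intro: power_decreasing)
      moreover have "B + 1 \<le> b * (B + 1)" using b B0 by simp
      ultimately show ?thesis using p B0 True unfolding Rbar_def by (simp add: mult_mono)
    qed
    moreover have "Rbar k \<noteq> 0" if "\<delta> \<noteq> 0" for k
      using that True B0 by (simp add: Rbar_def)
    moreover have "(\<lambda>k. Rbar (k + 1) / Rbar k) \<longlonglongrightarrow> p"
    \<comment> \<open>for \<open>p = 0\<close> the ratios are eventually \<open>0 / 0 = 0\<close>\<close>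
    proof (rule tendsto_eventually, rule eventually_sequentiallyI)
      fix k :: nat assume "k \<ge> 2"
      then obtain m where "k = Suc (Suc m)" by (metis Suc_le_D numeral_2_eq_2 Suc_le_mono)
      then show "Rbar (k + 1) / Rbar k = p" using B0 by (simp add: Rbar_def)
    qed
    ultimately show ?thesis by blast
  next
    case False
    then have p\<delta>: "p < \<delta>" using p\<delta> by simp

    \<comment> \<open>Decay of \<open>R\<close> at every rate above \<open>p\<close>\<close>
    obtain \<rho> where \<rho>: "0 < \<rho>" "\<rho> < 1" "p + \<phi> B / \<rho> ^ M \<le> \<rho>"
    proof -
      \<comment> \<open>At \<open>x = 1\<close> the wanted inequality is
        \<open>\<delta> < 1\<close>, which is strict, so by continuity it survives slightly below
        1.\<close>
      have "((\<lambda>x. x - \<phi> B / x ^ M) \<longlongrightarrow> 1 - \<phi> B / 1 ^ M) (at_left 1)"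
        by (intro tendsto_intros) auto
      moreover have "p < 1 - \<phi> B / 1 ^ M" using \<delta>1 \<delta>\<phi> by simp
      ultimately have "eventually (\<lambda>x. p < x - \<phi> B / x ^ M) (at_left 1)" by (rule order_tendstoD)
      moreover have "eventually (\<lambda>x::real. x \<in> {0<..<1}) (at_left 1)"
        by (rule eventually_at_left_real) simp
      ultimately have "eventually (\<lambda>x. x \<in> {0<..<1} \<and> p < x - \<phi> B / x ^ M) (at_left 1)"
        by eventually_elim simp
      then obtain x where "x \<in> {0<..<1}" "p < x - \<phi> B / x ^ M"
        using eventually_happens trivial_limit_at_left_real by (metis (no_types, lifting))
      then show ?thesis using that[of x] by simp
    qed
    have "\<exists>C. \<forall>k. T k \<le> C * \<rho> ^ k"
      using \<rho> p \<phi>0 step[OF \<phi>R]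
      by (intro window_recursion_decay[where p = p and \<sigma> = "\<phi> B" and M = M and K = 0]) auto
    then obtain C where C: "\<And>k. T k \<le> C * \<rho> ^ k" by blast
    have "(\<lambda>k. R (Suc k)) \<longlonglongrightarrow> 0"
    proof (rule tendsto_sandwich[where f = "\<lambda>_. 0" and h = "\<lambda>k. C * \<rho> ^ k"])
      show "(\<lambda>k. C * \<rho> ^ k) \<longlonglongrightarrow> 0"
        using \<rho> by (intro tendsto_mult_right_zero LIMSEQ_power_zero) auto
      show "\<forall>\<^sub>F k in sequentially. R (Suc k) \<le> C * \<rho> ^ k"
        using RT C by (intro always_eventually) (auto intro: order_trans)
    qed (use R in auto)
    then have lim: "(\<lambda>k. \<phi> (R (Suc k))) \<longlonglongrightarrow> (\<Sum>j=1..J. s j * 0)"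
      unfolding \<phi>_def
    proof (intro tendsto_intros)
      fix j assume j: "j \<in> {1..J}"
      assume "(\<lambda>k. R (Suc k)) \<longlonglongrightarrow> 0"
      then have "(\<lambda>k. R (Suc k) powr (\<eta> j - 1)) \<longlonglongrightarrow> 0 powr (\<eta> j - 1)"
        using \<eta>[OF j] R by (intro tendsto_powr') auto
      then show "(\<lambda>k. R (Suc k) powr (\<eta> j - 1)) \<longlonglongrightarrow> 0" by simp
    qed
    have growth: "\<exists>C. \<forall>k. T k \<le> C * r ^ k" if r: "p < r" "r \<le> 1" for r
    proof -
      \<comment> \<open>Chosen so that \<open>p + \<sigma> / r ^ M = r\<close>. Starting at
        \<open>K + M\<close> below keeps the whole window beyond \<open>K\<close>.\<close>
      define \<sigma> where "\<sigma> = (r - p) * r ^ M"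
      have r0: "r > 0" using p r by simp
      have \<sigma>: "\<sigma> > 0" using r r0 by (simp add: \<sigma>_def)
      have "eventually (\<lambda>k. \<phi> (R (Suc k)) < \<sigma>) sequentially"
        using order_tendstoD(2)[OF lim] \<sigma> by simp
      then obtain K where K: "\<And>k. k \<ge> K \<Longrightarrow> \<phi> (R (Suc k)) < \<sigma>"
        unfolding eventually_sequentially by blast
      show ?thesis
      proof (rule window_recursion_decay[where \<sigma> = \<sigma> and K = "K + M"])
        fix k assume "K + M \<le> k"
        then show "\<exists>q\<in>{k - M..k}. T (Suc k) \<le> p * T k + \<sigma> * T q"
          using K by (intro step) (auto intro!: less_imp_le)
      qed (use p r r0 \<sigma> in \<open>auto simp: \<sigma>_def\<close>)
    qed
    \<comment> \<open>The decay lemma needs \<open>r \<le> 1\<close>, while the majorant needs all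
      \<open>r > p\<close>; for \<open>r > 1\<close> boundedness of \<open>R\<close> is
      enough.\<close>
    have R_growth: "\<exists>C. \<forall>k. R (Suc k) \<le> C * r ^ k" if r: "p < r" for r
    proof (cases "r \<le> 1")
      case True
      then show ?thesis using growth[OF r] RT by (meson order_trans)
    next
      case False
      have "R (Suc k) \<le> B * r ^ k" for k
      proof -
        have "B * 1 \<le> B * r ^ k" using False B0 by (intro mult_left_mono one_le_power) auto
        then show ?thesis using RB[of "Suc k"] by simp
      qed
      then show ?thesis by blast
    qed
    obtain V where V: "\<And>k. V k > 0" "\<And>k. R (Suc k) \<le> V k"
      "\<And>r. p < r \<Longrightarrow> \<exists>C. \<forall>k. V k \<le> C * r ^ k" "(\<lambda>k. V (Suc k) / V k) \<longlonglongrightarrow> p"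
    proof (rule ratio_convergent_majorant[where p = p and a = "\<lambda>k. R (Suc k)"])
      show "R (Suc k) \<ge> 0" for k using R by simp
    qed (use p R_growth in blast)+
    obtain C where C: "\<And>k. V k \<le> C * \<delta> ^ k" using V(3)[OF p\<delta>] by blast
    have \<delta>0: "\<delta> > 0" using p p\<delta> by simp
    have C0: "C > 0" using C[of 0] V(1)[of 0] by simp
    \<comment> \<open>\<open>V\<close> is indexed from 0, hence the shift. Raising the first term to
      at least \<open>C\<close> absorbs the constant in (ii).\<close>
    define Rbar where "Rbar k = (if k = 1 then max (V 0) C else V (k - 1))" for k
    have "R k \<le> Rbar k" if "k \<ge> 1" for k
      using V(2)[of "k - 1"] that by (auto simp: Rbar_def)
    moreover have "Rbar (k + 1) \<le> \<delta> ^ nat \<lceil>real k / real M\<rceil> * (b * Rbar 1)" if "k \<ge> 1" for k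
    proof -
      have "\<delta> ^ k \<le> \<delta> ^ nat \<lceil>real k / real M\<rceil>"
        using \<delta>0 \<delta>1 exponent_le[of k] by (auto intro: power_decreasing)
      moreover have "C \<le> b * Rbar 1"
        using mult_mono[of 1 b C "Rbar 1"] b C0 by (simp add: Rbar_def)
      ultimately have "\<delta> ^ k * C \<le> \<delta> ^ nat \<lceil>real k / real M\<rceil> * (b * Rbar 1)"
        using C0 \<delta>0 by (intro mult_mono) auto
      moreover have "Rbar (k + 1) \<le> \<delta> ^ k * C" using C[of k] that by (simp add: Rbar_def mult_ac)
      ultimately show ?thesis by simp
    qed
    moreover have "Rbar k \<noteq> 0" for k
      using V(1)[of 0] V(1)[of "k - 1"] by (auto simp: Rbar_def)
    moreover have "(\<lambda>k. Rbar (k + 1) / Rbar k) \<longlonglongrightarrow> p"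
    proof -
      \<comment> \<open>The offset 2 skips the ratios that involve the altered first term.\<close>
      have "(\<lambda>k. Rbar (k + 2 + 1) / Rbar (k + 2)) \<longlonglongrightarrow> p"
        using LIMSEQ_Suc[OF V(4)] by (simp add: Rbar_def)
      then show ?thesis by (rule LIMSEQ_offset)
    qed
    ultimately show ?thesis by blast
  qed
qed

end
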